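(* There is a $2$-colouring of $\mathbb{R}$ such that, for every $k\in\mathbb{N}$ with $k\geq 2$, there does not exist a set $X\subseteq\mathbb{R}$ with $|X|=\mathfrak{c}$ such that $FS_k(X)$ is monochromatic.
   Context: $\mathfrak{c}$ is the cardinality of $\mathbb{R}$. $FS_k(X)=\{\sum F:F\subseteq X,\ |F|=k\}$ (sums of $k$ distinct elements of $X$). *)

theory Defs
  imports Complex_Main "HOL-Library.Equipollence"
begin

definition FS :: "nat \<Rightarrow> 'a::comm_monoid_add set \<Rightarrow> 'a set" where
  "FS k X = {\<Sum>F | F. F \<subseteq> X \<and> finite F \<and> card F = k}"

definition colouring :: "nat \<Rightarrow> ('a \<Rightarrow> nat) \<Rightarrow> bool" where
  "colouring r c \<longleftrightarrow> range c \<subseteq> {..<r}"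

definition monochromatic :: "('a \<Rightarrow> nat) \<Rightarrow> 'a set \<Rightarrow> bool" where
  "monochromatic c S \<longleftrightarrow> (\<exists>i. \<forall>x\<in>S. c x = i)"

end

theory Submission
  imports Defs "HOL-Library.Disjoint_Sets" "HOL-Analysis.Continuum_Not_Denumerable"
begin

text \<open>Fix a Hamel basis of the reals over the rationals and a well-order \<open>r\<close> of the reals, and
  apply Sierpinski's colouring (does \<open>r\<close> agree with \<open><\<close>?) to the closest pair of points in
  the support of a real. This pair is unique since two pairs at the same distance
  would be linearly dependent.
  An uncountable \<open>X\<close> is thinned out to a family whose supports have a fixed common part and
  otherwise run through the well-order like \<open>\<omega>\<^sub>1\<close>. Take \<open>k\<close> condensation points of
  it, two of them, \<open>v\<close> and \<open>w\<close>, much closer together than everything else. The closest pair of the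
  sum then consists of corresponding points of \<open>v\<close> and \<open>w\<close>, and this persists with the same
  \<open><\<close>-order when \<open>v\<close> and \<open>w\<close> move in small neighbourhoods. As these contain
  uncountably many members of the family, both \<open>r\<close>-orders, hence both colours, occur.\<close>

section \<open>Rational coordinates with respect to a Hamel basis\<close>

interpretation rat_real: vector_space "\<lambda>(q::rat) (x::real). of_rat q * x"
  by unfold_locales (auto simp: algebra_simps of_rat_add of_rat_mult)

definition hamel_basis :: "real set" where
  "hamel_basis = rat_real.extend_basis {}"

definition coord :: "real \<Rightarrow> real \<Rightarrow> rat" where
  "coord x = rat_real.representation hamel_basis x"

definition supp :: "real \<Rightarrow> real set" where
  "supp x = {b. coord x b \<noteq> 0}"

lemma independent_hamel_basis: "\<not> rat_real.dependent hamel_basis"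
  unfolding hamel_basis_def
  by (rule rat_real.independent_extend_basis) (rule rat_real.independent_empty)

lemma span_hamel_basis: "rat_real.span hamel_basis = UNIV"
  unfolding hamel_basis_def
  by (rule rat_real.span_extend_basis) (rule rat_real.independent_empty)

lemma finite_supp: "finite (supp x)"
  unfolding supp_def coord_def by (rule rat_real.finite_representation)

lemma supp_subset: "supp x \<subseteq> hamel_basis"
  unfolding supp_def coord_def using rat_real.representation_ne_zero by blast

lemma coord_add: "coord (x + y) b = coord x b + coord y b"
  unfolding coord_def
  by (simp add: rat_real.representation_add independent_hamel_basis span_hamel_basis)

lemma coord_sum: "finite F \<Longrightarrow> coord (\<Sum>F) b = (\<Sum>z\<in>F. coord z b)"
proof (induction F rule: finite_induct)
  case empty
  then show ?case by (simp add: coord_def rat_real.representation_zero)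
qed (simp add: coord_add)

lemma sum_coord: "(\<Sum>b\<in>supp x. of_rat (coord x b) * b) = x"
  unfolding supp_def coord_def
  using rat_real.sum_nonzero_representation_eq[OF independent_hamel_basis, of x]
  by (simp add: span_hamel_basis)

lemma coord_inject:
  assumes "coord x = coord y"
  shows "x = y"
proof -
  have "supp x = supp y" using assms by (simp only: supp_def)
  then have "(\<Sum>b\<in>supp x. of_rat (coord x b) * b) = (\<Sum>b\<in>supp y. of_rat (coord y b) * b)"
    by (simp only: assms)
  then show ?thesis by (simp only: sum_coord)
qed

lemma coord_basis:
  assumes "p \<in> hamel_basis"
  shows "coord p b = (if b = p then 1 else 0)"
  unfolding coord_def
  using rat_real.representation_basis[OF independent_hamel_basis assms] by auto

text \<open>In \<open>q + r = s + p\<close> the coefficient of \<open>q\<close> on the left is at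
  least 1, while \<open>p\<close> contributes 0 on the right; so \<open>s\<close> must be
  \<open>q\<close>.\<close>

lemma hamel_basis_diff_eq:
  assumes "{p, q, r, s} \<subseteq> hamel_basis" "p \<noteq> q" "q - p = s - r"
  shows "p = r \<and> q = s"
proof -
  have "q + r = s + p" using assms by linarith
  then have "coord q q + coord r q = coord s q + coord p q"
    by (metis coord_add)
  then have "q = s" using assms by (auto simp: coord_basis split: if_splits)
  then show ?thesis using assms by auto
qed

section \<open>Closest pairs in finite sets and their stability\<close>

text \<open>The strict inequality builds uniqueness into the notion and lets it survive small
  movements of finitely many points.\<close>

definition closest :: "real set \<Rightarrow> real \<Rightarrow> real \<Rightarrow> bool" where
  "closest S p q \<longleftrightarrow> p \<in> S \<and> q \<in> S \<and> p < q \<and>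
     (\<forall>r\<in>S. \<forall>s\<in>S. r < s \<longrightarrow> (r, s) \<noteq> (p, q) \<longrightarrow> q - p < s - r)"

lemma closest_unique: "closest S p q \<Longrightarrow> closest S p' q' \<Longrightarrow> p' = p \<and> q' = q"
  unfolding closest_def by (metis Pair_inject less_asym)

text \<open>Finiteness yields a pair at minimal distance; by \<open>hamel_basis_diff_eq\<close> no
  other pair in the basis has the same distance, so the minimum is strict.\<close>

lemma closest_exists:
  assumes "finite S" "S \<subseteq> hamel_basis" "x \<in> S" "y \<in> S" "x < y"
  shows "\<exists>p q. closest S p q"
proof -
  let ?P = "{u \<in> S \<times> S. fst u < snd u}"
  let ?d = "\<lambda>u. snd u - fst u :: real"
  have fin: "finite ?P" and ne: "?P \<noteq> {}" using assms by auto
  define u where "u = arg_min_on ?d ?P"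
  have u: "u \<in> ?P" and min: "\<forall>v\<in>?P. ?d u \<le> ?d v"
    using arg_min_if_finite(1)[OF fin ne, of ?d] arg_min_least[OF fin ne, of _ ?d]
    unfolding u_def by blast+
  obtain p q where pq: "u = (p, q)" by (cases u)
  have "q - p < s - r" if "r \<in> S" "s \<in> S" "r < s" "(r, s) \<noteq> (p, q)" for r s
  proof -
    have "q - p \<le> s - r" using min that pq by auto
    moreover have "q - p \<noteq> s - r"
      using hamel_basis_diff_eq[of p q r s] that u pq assms(2) by auto
    ultimately show ?thesis by simp
  qed
  then have "closest S p q" using u pq by (auto simp: closest_def)
  then show ?thesis by blast
qed

lemma finite_positive_lower_bound:
  fixes A :: "real set"
  assumes "finite A" "\<And>a. a \<in> A \<Longrightarrow> 0 < a"
  obtains e where "0 < e" "\<And>a. a \<in> A \<Longrightarrow> e \<le> a"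
  using assms
proof (cases "A = {}")
  case True
  then show ?thesis using that[of 1] by auto
next
  case False
  then show ?thesis using that[of "Min A"] assms by auto
qed

text \<open>Finitely many strict inequalities between differences of the \<open>f c\<close> say that
  the pair is closest, and all of them survive a movement smaller than a quarter of the least slack.
  Indexing by \<open>L\<close> keeps track of which point is which.\<close>

lemma closest_perturb:
  fixes f :: "'l \<Rightarrow> real"
  assumes "finite L" "a \<in> L" "b \<in> L" "inj_on f L" "closest (f ` L) (f a) (f b)"
  obtains e where "0 < e"
    "\<And>g. (\<And>c. c \<in> L \<Longrightarrow> \<bar>g c - f c\<bar> < e) \<Longrightarrow> inj_on g L \<and> closest (g ` L) (g a) (g b)"
proof -
  have lt: "f a < f b" using assms(5) by (simp add: closest_def)
  let ?P = "{(c, d) \<in> L \<times> L. f c < f d \<and> (c, d) \<noteq> (a, b)}"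
  \<comment> \<open>The first element protects the order of the pair itself, the others protect its
    lead over the competing pairs.\<close>
  let ?A = "insert (f b - f a) ((\<lambda>(c, d). f d - f c - (f b - f a)) ` ?P)"
  have "finite ?P" by (rule finite_subset[of _ "L \<times> L"]) (use assms in auto)
  then have finA: "finite ?A" by simp
  have "f b - f a < f d - f c" if "c \<in> L" "d \<in> L" "f c < f d" "(c, d) \<noteq> (a, b)" for c d
  proof -
    have "(f c, f d) \<noteq> (f a, f b)"
      using that assms(2-4) by (auto dest: inj_onD)
    then show ?thesis using assms(5) that by (simp add: closest_def)
  qed
  then have posA: "0 < x" if "x \<in> ?A" for x
    using that lt by auto
  obtain e where e: "0 < e" "\<And>x. x \<in> ?A \<Longrightarrow> e \<le> x"
    using finite_positive_lower_bound[OF finA posA] by blast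
  have eab: "e \<le> f b - f a" using e(2) by simp
  have ecd: "e \<le> f d - f c - (f b - f a)"
    if "c \<in> L" "d \<in> L" "f c < f d" "(c, d) \<noteq> (a, b)" for c d
    using e(2)[of "f d - f c - (f b - f a)"] that by force
  have "inj_on g L \<and> closest (g ` L) (g a) (g b)"
    \<comment> \<open>Comparing two distances involves four points, hence the quarter.\<close>
    if g: "\<And>c. c \<in> L \<Longrightarrow> \<bar>g c - f c\<bar> < e / 4" for g
  proof -
    have gab: "g a < g b" using g[OF assms(2)] g[OF assms(3)] eab by linarith
    have far: "g b - g a < g d - g c"
      if "c \<in> L" "d \<in> L" "f c < f d" "(c, d) \<noteq> (a, b)" for c d
      using ecd[OF that] g[OF assms(2)] g[OF assms(3)] g[OF that(1)] g[OF that(2)] by linarith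
    have mono: "g c < g d" if "c \<in> L" "d \<in> L" "f c < f d" for c d
      using far[OF that] gab by (cases "(c, d) = (a, b)") auto
    have inj: "inj_on g L"
      by (rule inj_onI) (metis assms(4) inj_onD linorder_neqE_linordered_idom mono order_less_irrefl)
    have "g b - g a < g d - g c" if "c \<in> L" "d \<in> L" "g c < g d" "(g c, g d) \<noteq> (g a, g b)" for c d
      using far[of c d] mono[of d c] that
      by (metis assms(4) inj_onD linorder_neqE_linordered_idom order_less_asym Pair_inject)
    then show ?thesis using inj gab assms by (auto simp: closest_def)
  qed
  then show ?thesis using that[of "e / 4"] e by auto
qed

section \<open>Thinning out uncountable sets\<close>

lemma uncountable_fibre:
  fixes f :: "'a \<Rightarrow> 'b :: countable"
  assumes "uncountable Y"
  obtains b where "uncountable {y \<in> Y. f y = b}"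
proof -
  have "Y = (\<Union>b. {y \<in> Y. f y = b})" by auto
  then have "\<exists>b. uncountable {y \<in> Y. f y = b}"
    using assms countable_UN[OF countableI_type, of UNIV "\<lambda>b. {y \<in> Y. f y = b}"] by auto
  then show ?thesis using that by blast
qed

lemma exists_minimal_if_wf:
  assumes "wf R" "\<exists>x. P x"
  shows "\<exists>x. P x \<and> (\<forall>y. (y, x) \<in> R \<longrightarrow> \<not> P y)"
proof -
  obtain x where "x \<in> Collect P" using assms(2) by auto
  then show ?thesis
    using iffD1[OF wf_eq_minimal assms(1), THEN spec, of "Collect P"] by auto
qed

text \<open>If some initial segment of \<open>r\<close> has uncountable preimage, take the least
  bound \<open>b\<close> of such a segment: either the fibre over \<open>b\<close> is uncountable,
  or the part strictly below \<open>b\<close> is, and there all smaller segments have countable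
  preimages.\<close>

lemma uncountable_thin_out:
  assumes r: "well_order_on UNIV r" and "uncountable Y"
  obtains Z where "Z \<subseteq> Y" "uncountable Z"
    "(\<exists>b. \<forall>z\<in>Z. f z = b) \<or> (\<forall>z\<in>Z. countable {y \<in> Z. (f y, f z) \<in> r})"
proof (cases "\<forall>b. countable {y \<in> Y. (f y, b) \<in> r}")
  case True
  then show ?thesis using that[of Y] assms by auto
next
  case False
  define P where "P b \<longleftrightarrow> uncountable {y \<in> Y. (f y, b) \<in> r}" for b
  have "wf (r - Id)" using r by (simp add: well_order_on_def)
  moreover have "\<exists>b. P b" using False by (simp add: P_def)
  ultimately obtain b where "P b" "\<forall>c. (c, b) \<in> r - Id \<longrightarrow> \<not> P c"
    using exists_minimal_if_wf by metis
  then have b: "uncountable {y \<in> Y. (f y, b) \<in> r}"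
    and min: "\<And>c. (c, b) \<in> r - Id \<Longrightarrow> countable {y \<in> Y. (f y, c) \<in> r}"
    by (simp_all add: P_def)
  let ?Z = "{y \<in> Y. (f y, b) \<in> r - Id}"
  have "{y \<in> Y. (f y, b) \<in> r} \<subseteq> ?Z \<union> {y \<in> Y. f y = b}" by auto
  then consider "uncountable ?Z" | "uncountable {y \<in> Y. f y = b}"
    using b by (meson countable_Un countable_subset)
  then show ?thesis
  proof cases
    case 1
    have "countable {y \<in> ?Z. (f y, f z) \<in> r}" if "z \<in> ?Z" for z
      by (rule countable_subset[OF _ min[of "f z"]]) (use that in auto)
    then show ?thesis using that[of ?Z] 1 by auto
  next
    case 2
    then show ?thesis using that[of "{y \<in> Y. f y = b}"] by auto
  qed
qed

text \<open>Both alternatives pass to subsets, so the functions can be treated one after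
  another.\<close>

lemma uncountable_thin_out_finite:
  assumes r: "well_order_on UNIV r" and "finite J" "uncountable Y"
  shows "\<exists>Z\<subseteq>Y. uncountable Z \<and>
    (\<forall>i\<in>J. (\<exists>b. \<forall>z\<in>Z. f i z = b) \<or> (\<forall>z\<in>Z. countable {y \<in> Z. (f i y, f i z) \<in> r}))"
  using assms(2)
proof (induction J rule: finite_induct)
  case empty
  then show ?case using assms by auto
next
  case (insert j J)
  then obtain Z where Z: "Z \<subseteq> Y" "uncountable Z" and
    J: "\<forall>i\<in>J. (\<exists>b. \<forall>z\<in>Z. f i z = b) \<or> (\<forall>z\<in>Z. countable {y \<in> Z. (f i y, f i z) \<in> r})"
    by blast
  obtain Z' where Z': "Z' \<subseteq> Z" "uncountable Z'" and
    j: "(\<exists>b. \<forall>z\<in>Z'. f j z = b) \<or> (\<forall>z\<in>Z'. countable {y \<in> Z'. (f j y, f j z) \<in> r})"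
    using uncountable_thin_out[OF r Z(2)] by blast
  have "countable {y \<in> Z'. (f i y, f i z) \<in> r}" if "countable {y \<in> Z. (f i y, f i z) \<in> r}" for i z
    by (rule countable_subset[OF _ that]) (use Z' in auto)
  then have "(\<exists>b. \<forall>z\<in>Z'. f i z = b) \<or> (\<forall>z\<in>Z'. countable {y \<in> Z'. (f i y, f i z) \<in> r})"
    if "i \<in> J" for i
    using bspec[OF J that] Z'(1) by (meson subsetD)
  then show ?case using j Z' Z by (intro exI[of _ Z']) auto
qed

text \<open>A point with a countable neighbourhood lies in a cell of a fine enough grid that has
  only countably many members, and over all meshes there are only countably many cells.\<close>

lemma countable_non_condensation_points:
  fixes p :: "'i \<Rightarrow> 'a \<Rightarrow> real"
  assumes "finite I"
  shows "countable {z \<in> Z. \<exists>e>0. countable {y \<in> Z. \<forall>i\<in>I. \<bar>p i y - p i z\<bar> < e}}" (is "countable ?B")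
proof -
  obtain xs where xs: "set xs = I" using finite_list[OF assms] by blast
  \<comment> \<open>The cell of \<open>z\<close> in the grid of mesh \<open>1 / Suc N\<close>, as a
    list of integers so that keys form a countable type.\<close>
  define key where "key N z = map (\<lambda>i. \<lfloor>p i z * real (Suc N)\<rfloor>) xs" for N z
  let ?K = "\<lambda>N. {k. countable {y \<in> Z. key N y = k}}"
  have "?B \<subseteq> (\<Union>N. \<Union>k\<in>?K N. {y \<in> Z. key N y = k})"
  proof
    fix z assume "z \<in> ?B"
    then obtain e where z: "z \<in> Z" and e: "e > 0"
      "countable {y \<in> Z. \<forall>i\<in>I. \<bar>p i y - p i z\<bar> < e}" by blast
    obtain N where N: "1 / real (Suc N) < e" using e(1) nat_approx_posE by blast
    have "\<bar>p i y - p i z\<bar> < e" if "key N y = key N z" "i \<in> I" for y i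
    proof -
      have "\<lfloor>p i y * real (Suc N)\<rfloor> = \<lfloor>p i z * real (Suc N)\<rfloor>"
        using that xs by (auto simp: key_def)
      then have "\<bar>p i y * real (Suc N) - p i z * real (Suc N)\<bar> < 1" by linarith
      then have "\<bar>p i y - p i z\<bar> * real (Suc N) < 1"
        by (simp add: left_diff_distrib[symmetric] abs_mult del: of_nat_Suc)
      then show ?thesis using N
        by (smt (verit) less_divide_eq of_nat_0_less_iff zero_less_Suc)
    qed
    then have "{y \<in> Z. key N y = key N z} \<subseteq> {y \<in> Z. \<forall>i\<in>I. \<bar>p i y - p i z\<bar> < e}" by blast
    then have "countable {y \<in> Z. key N y = key N z}" using e(2) countable_subset by blast
    then show "z \<in> (\<Union>N. \<Union>k\<in>?K N. {y \<in> Z. key N y = k})" using z by blast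
  qed
  moreover have "countable (\<Union>N. \<Union>k\<in>?K N. {y \<in> Z. key N y = k})" by auto
  ultimately show ?thesis by (rule countable_subset)
qed

section \<open>Thin families and their existence\<close>

text \<open>The parts \<open>{p i z | i \<in> I}\<close> need not be pairwise disjoint; but \<open>below\<close>, which makes
  each \<open>p i\<close> order \<open>Z\<close> like \<open>\<omega>\<^sub>1\<close>, lets each of them meet only countably many others.
  This replaces the Delta-system lemma.\<close>

locale thin_family =
  fixes r :: "(real \<times> real) set" and Z :: "real set" and I :: "nat set"
    and R :: "real set" and p :: "nat \<Rightarrow> real \<Rightarrow> real" and \<kappa> :: "real \<Rightarrow> rat"
  assumes r: "well_order_on UNIV r"
    and unc: "uncountable Z"
    and fin: "finite I" and ne: "I \<noteq> {}"
    and supp_eq: "z \<in> Z \<Longrightarrow> supp z = R \<union> (\<lambda>i. p i z) ` I"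
    and disj: "z \<in> Z \<Longrightarrow> i \<in> I \<Longrightarrow> p i z \<notin> R"
    and inj: "z \<in> Z \<Longrightarrow> inj_on (\<lambda>i. p i z) I"
    and coeff: "z \<in> Z \<Longrightarrow> b \<in> R \<Longrightarrow> coord z b = \<kappa> b"
    and below: "z \<in> Z \<Longrightarrow> i \<in> I \<Longrightarrow> countable {y \<in> Z. (p i y, p i z) \<in> r}"

text \<open>List each support in increasing order and thin out position by position: positions with
  constant entry make up \<open>R\<close>, the remaining ones are indexed by
  \<open>I\<close>.\<close>

lemma thin_family_exists:
  assumes r: "well_order_on UNIV r" and "uncountable X"
  obtains Z I R p \<kappa> where "Z \<subseteq> X" "thin_family r Z I R p \<kappa>"
proof -
  define l where "l x = sorted_list_of_set (supp x)" for x
  have l: "set (l x) = supp x" "distinct (l x)" for x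
    by (simp_all add: l_def finite_supp)
  \<comment> \<open>Lists of rationals form a countable type, so uncountably many members share one
    coefficient list and thereby the size of the support.\<close>
  obtain cs where Y: "uncountable {x \<in> X. map (coord x) (l x) = cs}" (is "uncountable ?Y")
    using uncountable_fibre[OF assms(2)] .
  let ?J = "{..<length cs}"
  obtain Z where Z: "Z \<subseteq> ?Y" "uncountable Z" and
    alt: "\<forall>i\<in>?J. (\<exists>b. \<forall>z\<in>Z. l z ! i = b) \<or> (\<forall>z\<in>Z. countable {y \<in> Z. (l y ! i, l z ! i) \<in> r})"
    using uncountable_thin_out_finite[OF r _ Y, of ?J "\<lambda>i x. l x ! i"] by auto
  have cs: "map (coord z) (l z) = cs" "length (l z) = length cs" if "z \<in> Z" for z
    using Z that by (auto dest: map_eq_imp_length_eq)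
  have cs_nth: "coord z (l z ! i) = cs ! i" if "z \<in> Z" "i \<in> ?J" for z i
    using cs[OF that(1)] that(2) by (metis lessThan_iff nth_map)
  define I where "I = {i \<in> ?J. \<not> (\<exists>b. \<forall>z\<in>Z. l z ! i = b)}"
  obtain z0 where z0: "z0 \<in> Z" using Z(2) by fastforce
  define R where "R = (\<lambda>i. l z0 ! i) ` (?J - I)"
  have const: "l z ! i = l z0 ! i" if "z \<in> Z" "i \<in> ?J - I" for z i
    using that z0 by (auto simp: I_def)
  have supp_eq: "supp z = (\<lambda>i. l z ! i) ` ?J" if "z \<in> Z" for z
    using l(1)[of z] cs(2)[OF that] by (auto simp: set_conv_nth)
  have inj: "inj_on (\<lambda>i. l z ! i) ?J" if "z \<in> Z" for z
    using l(2)[of z] cs(2)[OF that] by (auto simp: inj_on_def nth_eq_iff_index_eq)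
  have R_eq: "R = (\<lambda>i. l z ! i) ` (?J - I)" if "z \<in> Z" for z
    unfolding R_def using const[OF that] by auto
  have IJ: "I \<subseteq> ?J" by (auto simp: I_def)
  have coeff: "coord z b = coord z0 b" if "z \<in> Z" "b \<in> R" for z b
  proof -
    obtain i where i: "i \<in> ?J - I" "b = l z0 ! i" using \<open>b \<in> R\<close> by (auto simp: R_def)
    then show ?thesis
      using const[OF \<open>z \<in> Z\<close> i(1)] cs_nth[OF \<open>z \<in> Z\<close>, of i] cs_nth[OF z0, of i] by auto
  qed
  \<comment> \<open>With every position constant, all members would share support and coefficients,
    leaving a single real.\<close>
  have "I \<noteq> {}"
  proof
    assume I: "I = {}"
    have "z = z0" if z: "z \<in> Z" for z
    proof (rule coord_inject, rule ext)
      fix b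
      have "supp z = R" "supp z0 = R"
        using supp_eq[OF z] supp_eq[OF z0] R_eq[OF z] R_eq[OF z0] I by (metis Diff_empty)+
      then have "b \<notin> R \<Longrightarrow> coord z b = 0 \<and> coord z0 b = 0" unfolding supp_def by blast
      then show "coord z b = coord z0 b" using coeff[OF z, of b] by fastforce
    qed
    then have "Z \<subseteq> {z0}" by auto
    then show False using Z(2) by (meson countable_subset countable_insert countable_empty)
  qed
  moreover have "supp z = R \<union> (\<lambda>i. l z ! i) ` I" if "z \<in> Z" for z
    using supp_eq[OF that] R_eq[OF that] IJ by auto
  moreover have "l z ! i \<notin> R" if "z \<in> Z" "i \<in> I" for z i
    using R_eq[OF that(1)] inj[OF that(1)] that IJ by (auto simp: inj_on_def)
  moreover have "inj_on (\<lambda>i. l z ! i) I" if "z \<in> Z" for z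
    using inj[OF that] IJ inj_on_subset by blast
  moreover have "countable {y \<in> Z. (l y ! i, l z ! i) \<in> r}" if "z \<in> Z" "i \<in> I" for z i
    using bspec[OF alt, of i] that unfolding I_def by blast
  moreover have "finite I" using IJ finite_subset by blast
  ultimately have "thin_family r Z I R (\<lambda>i z. l z ! i) (coord z0)"
    unfolding thin_family_def using r Z(2) coeff by auto
  then show ?thesis using that Z(1) by blast
qed

section \<open>Sums and condensation points of a thin family\<close>

context thin_family
begin

definition own :: "real \<Rightarrow> real set" where
  "own z = (\<lambda>i. p i z) ` I"

lemma r_total: "x \<noteq> y \<Longrightarrow> (x, y) \<in> r \<or> (y, x) \<in> r"
  using r by (auto simp: well_order_on_def linear_order_on_def total_on_def)

lemma r_refl: "(x, x) \<in> r"
  using r by (auto simp: well_order_on_def linear_order_on_def partial_order_on_def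
      preorder_on_def refl_on_def)

text \<open>By reflexivity of \<open>r\<close>, each fibre of \<open>p i\<close> lies in a set that
  \<open>below\<close> makes countable.\<close>

lemma countable_own_meets:
  assumes "countable A"
  shows "countable {z \<in> Z. own z \<inter> A \<noteq> {}}"
proof -
  have fib: "countable {z \<in> Z. p i z = a}" if "i \<in> I" for i a
  proof (cases "\<exists>z\<in>Z. p i z = a")
    case True
    then obtain z where z: "z \<in> Z" "p i z = a" by blast
    show ?thesis
      by (rule countable_subset[OF _ below[OF z(1) that]]) (use z r_refl in auto)
  next
    case False
    then have "{z \<in> Z. p i z = a} = {}" by auto
    then show ?thesis by (metis countable_empty)
  qed
  have "countable (\<Union>i\<in>I. \<Union>a\<in>A. {z \<in> Z. p i z = a})"
    using fib assms fin by (intro countable_UN) (auto intro: countable_finite)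
  then show ?thesis
    by (rule countable_subset[rotated]) (auto simp: own_def)
qed

text \<open>Nothing cancels: at \<open>b\<close> in \<open>R\<close> the coefficient is
  \<open>card F\<close> times the nonzero \<open>\<kappa> b\<close>, and every other point of the
  supports belongs to just one summand.\<close>

lemma supp_sum:
  assumes F: "finite F" "F \<noteq> {}" "F \<subseteq> Z" and dis: "disjoint_family_on own F"
  shows "supp (\<Sum>F) = R \<union> (\<Union>z\<in>F. own z)"
proof -
  have sp: "supp z = R \<union> own z" if "z \<in> F" for z
    using supp_eq F that by (auto simp: own_def)
  have pR: "own z \<inter> R = {}" if "z \<in> F" for z
    using disj F that by (auto simp: own_def)
  have cs: "coord (\<Sum>F) b = (\<Sum>z\<in>F. coord z b)" for b using coord_sum F by blast
  have "coord (\<Sum>F) b \<noteq> 0" if b: "b \<in> R" for b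
  proof -
    obtain z where z: "z \<in> F" using F by blast
    have "coord (\<Sum>F) b = (\<Sum>z\<in>F. \<kappa> b)" unfolding cs using F b by (intro sum.cong) (auto simp: coeff)
    moreover have "\<kappa> b \<noteq> 0" using sp[OF z] coeff[of z b] subsetD[OF F(3) z] b by (auto simp: supp_def)
    ultimately show ?thesis using F by simp
  qed
  moreover have "coord (\<Sum>F) b \<noteq> 0" if z: "z \<in> F" "b \<in> own z" for b z
  proof -
    have "coord y b = 0" if "y \<in> F - {z}" for y
    proof -
      have "own z \<inter> own y = {}" using disjoint_family_onD[OF dis, of z y] that z by auto
      then have "b \<notin> supp y" using sp[of y] pR[OF z(1)] that z by blast
      then show ?thesis by (simp add: supp_def)
    qed
    then have "coord (\<Sum>F) b = coord z b"
      unfolding cs using F z sum.remove[of F z "\<lambda>z. coord z b"] by simp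
    then show ?thesis using sp[OF z(1)] z by (auto simp: supp_def)
  qed
  moreover have "coord (\<Sum>F) b = 0" if "b \<notin> R \<union> (\<Union>z\<in>F. own z)" for b
    unfolding cs using sp that by (intro sum.neutral) (auto simp: supp_def)
  ultimately show ?thesis unfolding supp_def by blast
qed

definition near :: "real \<Rightarrow> real \<Rightarrow> real set" where
  "near z e = {y \<in> Z. \<forall>i\<in>I. \<bar>p i y - p i z\<bar> < e}"

text \<open>Condensation points with respect to the maximum distance of the position vectors
  \<open>(p i z)\<close>, not the distance of the reals \<open>z\<close> themselves.\<close>

definition condensed :: "real set" where
  "condensed = {z \<in> Z. \<forall>e>0. uncountable (near z e)}"

lemma countable_not_condensed: "countable (Z - condensed)"
proof -
  have "Z - condensed = {z \<in> Z. \<exists>e>0. countable {y \<in> Z. \<forall>i\<in>I. \<bar>p i y - p i z\<bar> < e}}"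
    by (auto simp: condensed_def near_def)
  then show ?thesis using countable_non_condensation_points[OF fin, of Z p] by simp
qed

lemma condensed_avoiding:
  assumes "A \<subseteq> Z" "uncountable A" "countable B"
  obtains z where "z \<in> A" "z \<in> condensed" "own z \<inter> B = {}"
proof -
  let ?C = "(Z - condensed) \<union> {z \<in> Z. own z \<inter> B \<noteq> {}}"
  have "countable ?C" using countable_not_condensed countable_own_meets[OF assms(3)] by blast
  then have "\<not> A \<subseteq> ?C" using assms(2) countable_subset[of A ?C] by blast
  then obtain z where "z \<in> A" "z \<notin> ?C" by (meson subsetI)
  then show ?thesis using that[of z] assms(1) by auto
qed

lemma finite_own: "finite (own z)" by (simp add: own_def fin)

lemma own_nonempty: "own z \<noteq> {}" by (simp add: own_def ne)

text \<open>Greedy choice: the points used so far are finitely many, so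
  \<open>condensed_avoiding\<close> supplies a further member.\<close>

lemma condensed_disjoint:
  "\<exists>W\<subseteq>condensed. finite W \<and> card W = m \<and> disjoint_family_on own W"
proof (induction m)
  case 0
  then show ?case by (intro exI[of _ "{}"]) (auto simp: disjoint_family_on_def)
next
  case (Suc m)
  then obtain W where W: "W \<subseteq> condensed" "finite W" "card W = m" "disjoint_family_on own W"
    by blast
  obtain z where z: "z \<in> Z" "z \<in> condensed" "own z \<inter> (\<Union>w\<in>W. own w) = {}"
    using condensed_avoiding[OF order_refl unc, of "\<Union>w\<in>W. own w"] W(2) finite_own
    by (metis countable_finite finite_UN)
  have "z \<notin> W" using z(3) own_nonempty by blast
  then show ?case using W z
    by (intro exI[of _ "insert z W"]) (auto simp: disjoint_family_on_def)
qed

section \<open>Locating the closest pair and realising both orders\<close>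

text \<open>Points of the support are addressed by labels, so that they can be followed while
  the two summands \<open>a\<close> and \<open>b\<close> move.\<close>

definition pos :: "real \<Rightarrow> real \<Rightarrow> real + nat \<times> bool \<Rightarrow> real" where
  "pos a b c = (case c of Inl x \<Rightarrow> x | Inr (i, t) \<Rightarrow> p i (if t then b else a))"

definition labels :: "real set \<Rightarrow> (real + nat \<times> bool) set" where
  "labels S = Inl ` S \<union> Inr ` (I \<times> UNIV)"

lemma pos_simps [simp]: "pos a b (Inl x) = x" "pos a b (Inr (i, t)) = p i (if t then b else a)"
  by (simp_all add: pos_def)

lemma pos_labels: "pos a b ` labels S = S \<union> own a \<union> own b"
  by (force simp: labels_def own_def image_Un image_image split: if_splits)

lemma finite_labels: "finite S \<Longrightarrow> finite (labels S)"
  by (simp add: labels_def fin)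

lemma near_pos:
  assumes "a \<in> near v e" "b \<in> near w e" "0 < e" "c \<in> labels S"
  shows "\<bar>pos a b c - pos v w c\<bar> < e"
  using assms by (auto simp: labels_def near_def)

text \<open>Let \<open>w\<close> be within a quarter of the least distance \<open>e\<close> in
  \<open>S \<union> own v\<close>. Corresponding points of \<open>v\<close> and \<open>w\<close> are
  then less than \<open>e / 4\<close> apart, all other pairs more than \<open>e / 2\<close>. The
  boolean \<open>t\<close> records which of the two has the left point.\<close>

lemma closest_pair_same_index:
  assumes S: "finite S" "own v \<inter> S = {}" "S \<subseteq> hamel_basis" and v: "v \<in> condensed"
  obtains w i t where "w \<in> condensed" "i \<in> I" "inj_on (pos v w) (labels S)"
    "closest (pos v w ` labels S) (pos v w (Inr (i, t))) (pos v w (Inr (i, \<not> t)))"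
proof -
  let ?S = "S \<union> own v"
  let ?D = "(\<lambda>(x, y). \<bar>x - y\<bar>) ` {u \<in> ?S \<times> ?S. fst u \<noteq> snd u}"
  have vZ: "v \<in> Z" using v by (simp add: condensed_def)
  have "finite ?D" using S finite_own by auto
  then obtain e where e: "0 < e" "\<And>d. d \<in> ?D \<Longrightarrow> e \<le> d"
    by (rule finite_positive_lower_bound) auto
  have sep: "e \<le> \<bar>x - y\<bar>" if "x \<in> ?S" "y \<in> ?S" "x \<noteq> y" for x y
    using e(2)[of "\<bar>x - y\<bar>"] that by force
  have "uncountable (near v (e / 4))" using v e by (simp add: condensed_def)
  moreover have "near v (e / 4) \<subseteq> Z" by (auto simp: near_def)
  moreover have "countable ?S" using S finite_own by (simp add: countable_finite)
  ultimately obtain w where w: "w \<in> near v (e / 4)" "w \<in> condensed" "own w \<inter> ?S = {}"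
    using condensed_avoiding by metis
  have wZ: "w \<in> Z" using w by (simp add: near_def)
  have vnear: "v \<in> near v (e / 4)" using vZ e by (simp add: near_def)
  \<comment> \<open>\<open>pos v v\<close> is the limiting configuration with \<open>w\<close>
    merged into \<open>v\<close>: labels that coincide there are twins, all others are at least
    \<open>e\<close> apart and lose less than \<open>e / 4\<close> at each end.\<close>
  have twin: "(\<exists>i t. i \<in> I \<and> c = Inr (i, t) \<and> d = Inr (i, \<not> t)) \<or> e / 2 < \<bar>pos v w c - pos v w d\<bar>"
    if c: "c \<in> labels S" "d \<in> labels S" "c \<noteq> d" for c d
  proof (cases "pos v v c = pos v v d")
    case True
    have notS: "p i v \<notin> S" if "i \<in> I" for i using S(2) that by (auto simp: own_def)
    have "\<exists>i t. i \<in> I \<and> c = Inr (i, t) \<and> d = Inr (i, \<not> t)"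
    proof (cases c)
      case (Inl x)
      then show ?thesis using c True notS by (cases d) (auto simp: labels_def)
    next
      case (Inr u)
      then obtain i t where i: "c = Inr (i, t)" "i \<in> I" using c by (auto simp: labels_def)
      then obtain j s where j: "d = Inr (j, s)" "j \<in> I"
        using c True notS by (cases d) (auto simp: labels_def)
      have "i = j" using True inj_onD[OF inj[OF vZ]] i j by simp
      then show ?thesis using i j c(3) by auto
    qed
    then show ?thesis by blast
  next
    case False
    have "pos v v c \<in> ?S" "pos v v d \<in> ?S" using c pos_labels[of v v S] by auto
    then have "e \<le> \<bar>pos v v c - pos v v d\<bar>" using sep False by blast
    moreover have "\<bar>pos v w c - pos v v c\<bar> < e / 4" "\<bar>pos v w d - pos v v d\<bar> < e / 4"
      using near_pos[OF vnear w(1)] c e by auto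
    ultimately show ?thesis by linarith
  qed
  have vw: "p i v \<noteq> p j w" if "i \<in> I" "j \<in> I" for i j
    using w(3) that by (auto simp: own_def)
  have inj': "inj_on (pos v w) (labels S)"
  proof (rule inj_onI, rule ccontr)
    fix c d assume cd: "c \<in> labels S" "d \<in> labels S" "pos v w c = pos v w d" "c \<noteq> d"
    have "\<not> e / 2 < \<bar>pos v w c - pos v w d\<bar>" using cd(3) e(1) by simp
    then obtain i t where "i \<in> I" "c = Inr (i, t)" "d = Inr (i, \<not> t)"
      using twin[OF cd(1,2,4)] by blast
    then show False using cd(3) vw[of i i] by (cases t) auto
  qed
  obtain i0 where i0: "i0 \<in> I" using ne by blast
  let ?T = "pos v w ` labels S"
  have i0T: "p i0 v \<in> ?T" "p i0 w \<in> ?T" using i0 by (auto simp: pos_labels own_def)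
  have "own v \<subseteq> hamel_basis" "own w \<subseteq> hamel_basis"
    using supp_eq[OF vZ] supp_eq[OF wZ] supp_subset by (auto simp: own_def)
  then have "?T \<subseteq> hamel_basis" using S by (simp add: pos_labels)
  moreover have "finite ?T" using finite_labels S by blast
  ultimately obtain x y where xy: "closest ?T x y"
    using closest_exists[of ?T] i0T vw[OF i0 i0] by (metis linorder_neqE_linordered_idom)
  then obtain c d where cd: "c \<in> labels S" "d \<in> labels S" "x = pos v w c" "y = pos v w d"
    by (auto simp: closest_def)
  \<comment> \<open>The corresponding points at \<open>i0\<close> bound the minimal distance, which
    excludes the second alternative of \<open>twin\<close>.\<close>
  have "\<bar>x - y\<bar> \<le> \<bar>p i0 v - p i0 w\<bar>"
    using xy i0T vw[OF i0 i0] unfolding closest_def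
    by (smt (verit) Pair_inject)
  also have "\<dots> < e / 4" using w(1) i0 by (auto simp: near_def abs_minus_commute)
  finally have "\<not> e / 2 < \<bar>pos v w c - pos v w d\<bar>" using cd e by simp
  moreover have "c \<noteq> d" using xy cd by (auto simp: closest_def)
  ultimately obtain i t where "i \<in> I" "c = Inr (i, t)" "d = Inr (i, \<not> t)"
    using twin[OF cd(1,2)] by blast
  then show ?thesis using that[OF w(2) _ inj', of i t] xy cd by blast
qed

lemma both_orders:
  assumes k: "2 \<le> k"
  obtains x y p1 q1 p2 q2 where "x \<in> FS k Z" "y \<in> FS k Z"
    "closest (supp x) p1 q1" "(p1, q1) \<in> r" "closest (supp y) p2 q2" "(p2, q2) \<notin> r"
proof -
  \<comment> \<open>One member \<open>v\<close> of \<open>W\<close> gets a close partner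
    \<open>w\<close>; the other \<open>k - 2\<close> stay fixed as \<open>V\<close>.\<close>
  obtain W where W: "W \<subseteq> condensed" "finite W" "card W = k - 1" "disjoint_family_on own W"
    using condensed_disjoint by blast
  obtain v where v: "v \<in> W" using W(3) k by fastforce
  define V where "V = W - {v}"
  have WZ: "W \<subseteq> Z" using W(1) by (auto simp: condensed_def)
  define S where "S = R \<union> (\<Union>z\<in>V. own z)"
  have V: "finite V" "V \<subseteq> Z" "card V = k - 2" "disjoint_family_on own V"
    using W WZ v k by (auto simp: V_def disjoint_family_on_def)
  have vZ: "v \<in> Z" using WZ v by blast
  have sp: "supp z = R \<union> own z" if "z \<in> Z" for z
    using supp_eq that by (auto simp: own_def)
  have R: "R \<subseteq> hamel_basis" "finite R"
    using sp[OF vZ] supp_subset[of v] finite_supp[of v] by auto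
  have S: "finite S" "own v \<inter> S = {}" "S \<subseteq> hamel_basis"
  proof -
    show "finite S" using R V finite_own by (simp add: S_def)
    have "own v \<inter> own z = {}" if "z \<in> V" for z
      using disjoint_family_onD[OF W(4) v, of z] that by (auto simp: V_def)
    then show "own v \<inter> S = {}"
      using disj[OF vZ] by (auto simp: S_def own_def)
    have "own z \<subseteq> hamel_basis" if "z \<in> V" for z using sp[of z] supp_subset[of z] V that by auto
    then show "S \<subseteq> hamel_basis" using R by (auto simp: S_def)
  qed
  obtain w i t where w: "w \<in> condensed" and i: "i \<in> I" and
    inj': "inj_on (pos v w) (labels S)" and
    cl: "closest (pos v w ` labels S) (pos v w (Inr (i, t))) (pos v w (Inr (i, \<not> t)))"
    using closest_pair_same_index[OF S] v W(1) by blast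
  have iL: "Inr (i, t') \<in> labels S" for t' using i by (simp add: labels_def)
  obtain e where e: "0 < e" and
    pert: "\<And>g. (\<And>c. c \<in> labels S \<Longrightarrow> \<bar>g c - pos v w c\<bar> < e) \<Longrightarrow>
      inj_on g (labels S) \<and> closest (g ` labels S) (g (Inr (i, t))) (g (Inr (i, \<not> t)))"
    using closest_perturb[OF finite_labels[OF S(1)] iL iL inj' cl] by blast
  have ab: "a + b + \<Sum>V \<in> FS k Z"
    "closest (supp (a + b + \<Sum>V)) (pos a b (Inr (i, t))) (pos a b (Inr (i, \<not> t)))"
    "p i a \<noteq> p i b"
    if "a \<in> near v e" "b \<in> near w e" for a b
  proof -
    have inj_ab: "inj_on (pos a b) (labels S)" and
      cl_ab: "closest (pos a b ` labels S) (pos a b (Inr (i, t))) (pos a b (Inr (i, \<not> t)))"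
      using pert[of "pos a b"] near_pos[OF that e] by auto
    have Zab: "a \<in> Z" "b \<in> Z" using that by (auto simp: near_def)
    have pab: "own a \<inter> own b = {}"
    proof -
      have "p j a \<noteq> p j' b" if "j \<in> I" "j' \<in> I" for j j'
        using inj_onD[OF inj_ab, of "Inr (j, False)" "Inr (j', True)"] that by (auto simp: labels_def)
      then show ?thesis by (auto simp: own_def)
    qed
    \<comment> \<open>A moving point inside \<open>S\<close> would carry an \<open>Inl\<close> label
      as well as its \<open>Inr\<close> label, against injectivity.\<close>
    have "p j (if s then b else a) \<notin> S" if "j \<in> I" for j s
      using inj_onD[OF inj_ab, of "Inr (j, s)" "Inl (p j (if s then b else a))"] that
      by (auto simp: labels_def)
    from this[where s = False] this[where s = True]
    have pS: "own a \<inter> S = {}" "own b \<inter> S = {}" by (auto simp: own_def)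
    have "z \<notin> V" if "own z \<inter> S = {}" for z
      using that own_nonempty[of z] unfolding S_def by auto
    then have V': "a \<notin> V" "b \<notin> V" using pS by auto
    have "a \<noteq> b" using pab own_nonempty by auto
    let ?F = "insert a (insert b V)"
    have sum: "\<Sum>?F = a + b + \<Sum>V" using V V' \<open>a \<noteq> b\<close> by (simp add: add.assoc)
    have F: "finite ?F" "?F \<subseteq> Z" "card ?F = k" using V V' \<open>a \<noteq> b\<close> Zab k by auto
    have dF: "disjoint_family_on own ?F"
    proof -
      have "own b \<inter> (\<Union>z\<in>V. own z) = {}" using pS unfolding S_def by blast
      then have "disjoint_family_on own (insert b V)"
        using V(4) by (simp only: disjoint_family_on_insert[OF V'(2)])
      moreover have "own a \<inter> (\<Union>z\<in>insert b V. own z) = {}" using pab pS unfolding S_def by blast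
      moreover have "a \<notin> insert b V" using V' \<open>a \<noteq> b\<close> by blast
      ultimately show ?thesis by (metis disjoint_family_on_insert)
    qed
    show "a + b + \<Sum>V \<in> FS k Z"
      unfolding FS_def by (rule CollectI, rule exI[of _ ?F]) (simp only: sum F simp_thms)
    have "supp (\<Sum>?F) = pos a b ` labels S"
      using supp_sum[OF F(1) _ F(2) dF] by (auto simp: pos_labels S_def)
    then show "closest (supp (a + b + \<Sum>V)) (pos a b (Inr (i, t))) (pos a b (Inr (i, \<not> t)))"
      using cl_ab sum by simp
    show "p i a \<noteq> p i b" using pab i by (auto simp: own_def)
  qed
  have unc_near: "uncountable (near v e)" "uncountable (near w e)"
    using v w W(1) e by (auto simp: condensed_def)
  \<comment> \<open>By \<open>below\<close>, only countably many members have their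
    \<open>i\<close>-th point at or before \<open>p i z\<close>, so an uncountable set contains one
    beyond it.\<close>
  have above: "\<exists>a\<in>A. (p i a, p i z) \<notin> r" if "uncountable A" "A \<subseteq> Z" "z \<in> Z" for A z
  proof (rule ccontr)
    assume "\<not> (\<exists>a\<in>A. (p i a, p i z) \<notin> r)"
    then have "A \<subseteq> {y \<in> Z. (p i y, p i z) \<in> r}" using that by auto
    then show False using that below i countable_subset by blast
  qed
  have nZ: "near z e \<subseteq> Z" for z by (auto simp: near_def)
  \<comment> \<open>Anchors: \<open>a1\<close> is chosen beyond \<open>b0\<close> and
    \<open>b1\<close> beyond \<open>a0\<close>, so the pairs \<open>(a1, b0)\<close> and
    \<open>(a0, b1)\<close> realise opposite \<open>r\<close>-orders.\<close>
  obtain a0 b0 where 0: "a0 \<in> near v e" "b0 \<in> near w e"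
    using unc_near by (metis countable_empty ex_in_conv)
  obtain a1 where a1: "a1 \<in> near v e" "(p i a1, p i b0) \<notin> r"
    using above[OF unc_near(1) nZ, of b0] 0 nZ by blast
  obtain b1 where b1: "b1 \<in> near w e" "(p i b1, p i a0) \<notin> r"
    using above[OF unc_near(2) nZ, of a0] 0 nZ by blast
  have r1: "(p i b0, p i a1) \<in> r" using a1 ab(3)[OF a1(1) 0(2)] r_total by metis
  have r0: "(p i a0, p i b1) \<in> r" using b1 ab(3)[OF 0(1) b1(1)] r_total by metis
  show ?thesis
  \<comment> \<open>If \<open>t\<close> holds, the left point of the closest pair comes from the
    second summand, so \<open>(a1, b0)\<close> gives the pair in \<open>r\<close>; otherwise
    \<open>(a0, b1)\<close> does.\<close>
  proof (cases t)
    case True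
    then show ?thesis
      using that[OF ab(1)[OF a1(1) 0(2)] ab(1)[OF 0(1) b1(1)] ab(2)[OF a1(1) 0(2)] _ ab(2)[OF 0(1) b1(1)]]
        r1 b1(2) by simp
  next
    case False
    then show ?thesis
      using that[OF ab(1)[OF 0(1) b1(1)] ab(1)[OF a1(1) 0(2)] ab(2)[OF 0(1) b1(1)] _ ab(2)[OF a1(1) 0(2)]]
        r0 a1(2) by simp
  qed
qed

end

section \<open>The colouring\<close>

theorem theorem3p2:
  "\<exists>c :: real \<Rightarrow> nat. colouring 2 c \<and>
     (\<forall>k\<ge>2. \<not> (\<exists>X :: real set. X \<approx> (UNIV :: real set) \<and> monochromatic c (FS k X)))"
proof -
  obtain r :: "(real \<times> real) set" where r: "well_order_on UNIV r" using well_order_on by blast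
  define c :: "real \<Rightarrow> nat"
    \<comment> \<open>As \<open>p < q\<close> in a closest pair, colour 0 says that \<open>r\<close>
      and \<open><\<close> agree on it. Reals whose support has no closest pair get the default
      1.\<close>
    where "c x = (if \<exists>p q. closest (supp x) p q \<and> (p, q) \<in> r then 0 else 1)" for x
  have "\<not> monochromatic c (FS k X)" if k: "k \<ge> 2" and X: "X \<approx> (UNIV :: real set)" for k X
  proof
    assume mono: "monochromatic c (FS k X)"
    have "uncountable X" using X uncountable_UNIV_real by (metis countable_eqpoll eqpoll_sym)
    then obtain Z I R p \<kappa> where Z: "Z \<subseteq> X" "thin_family r Z I R p \<kappa>"
      using thin_family_exists[OF r] by metis
    obtain x y p1 q1 p2 q2 where xy: "x \<in> FS k Z" "y \<in> FS k Z"
      "closest (supp x) p1 q1" "(p1, q1) \<in> r" "closest (supp y) p2 q2" "(p2, q2) \<notin> r"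
      using thin_family.both_orders[OF Z(2) k] by metis
    have "FS k Z \<subseteq> FS k X" using Z(1) unfolding FS_def by blast
    then have "c x = c y" using mono xy unfolding monochromatic_def by (metis subsetD)
    moreover have "c x = 0" using xy by (auto simp: c_def)
    moreover have "c y = 1"
    proof -
      \<comment> \<open>Colour 1 requires every closest pair to lie outside \<open>r\<close>;
        uniqueness reduces this to the one already found.\<close>
      have "(p, q) \<notin> r" if "closest (supp y) p q" for p q
        using closest_unique[OF xy(5) that] xy(6) by simp
      then show ?thesis by (auto simp: c_def)
    qed
    ultimately show False by simp
  qed
  moreover have "colouring 2 c" by (auto simp: colouring_def c_def)
  ultimately show ?thesis by blast
qed

end
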